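(* Suppose that $a_1, a_2, \ldots, a_n$ is a finite sequence of distinct positive real numbers. Then there exists a polynomial $p$ (with complex coefficients), of degree $2n+1$, such that for each $k \in \{1, \ldots, n\}$ the maximum modulus set $\mathcal{M}(p)$ has a discontinuity of modulus $a_k$.
   Context: For an entire function $f:\mathbb{C}\to\mathbb{C}$ (in particular a polynomial), the maximum modulus is $M(r,f) := \max_{|z|=r}|f(z)|$ for $r \ge 0$, and the maximum modulus set is $\mathcal{M}(f) := \{z \in \mathbb{C} : |f(z)| = M(|z|,f)\}$. For $r>0$, we say that $\mathcal{M}(f)$ has a discontinuity of modulus $r$ if there exists a connected component $\Gamma$ of $\mathcal{M}(f)$ such that $\min\{|z| : z \in \Gamma\} = r$. *)

theory Defs
  imports "HOL-Analysis.Analysis" "HOL-Computational_Algebra.Polynomial"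
begin

(* For continuous f and r \<ge> 0 the circle is nonempty and compact, so the supremum is attained and
   is the maximum; for r < 0 the circle is empty and the value is meaningless. *)
definition max_modulus :: "real \<Rightarrow> (complex \<Rightarrow> complex) \<Rightarrow> real" where
  "max_modulus r f = (SUP z\<in>sphere 0 r. norm (f z))"

definition max_modulus_set :: "(complex \<Rightarrow> complex) \<Rightarrow> complex set" where
  "max_modulus_set f = {z. norm (f z) = max_modulus (norm z) f}"

(* The minimum of the moduli on the component is required to be attained, which an equation with
   Inf would not say. *)
definition discontinuity_of_modulus :: "(complex \<Rightarrow> complex) \<Rightarrow> real \<Rightarrow> bool" where
  "discontinuity_of_modulus f r \<longleftrightarrow>
     r > 0 \<and>
     (\<exists>\<Gamma>\<in>components (max_modulus_set f).
        (\<exists>z\<in>\<Gamma>. norm z = r) \<and> (\<forall>z\<in>\<Gamma>. r \<le> norm z))"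

end

theory Submission
  imports Defs
begin

text \<open>
  Let \<open>A\<close> be the set of prescribed moduli and \<open>n\<close> its size. The polynomial is
  \<open>p z = 1 + z\<^sup>2 + \<epsilon> O(z)\<close>, where \<open>O(z) = z \<Prod>\<^sub>b (z\<^sup>2 - b\<^sup>2)\<close>, with \<open>b\<close> ranging
  over \<open>A\<close>, is odd of degree \<open>2n + 1\<close> and \<open>\<epsilon> > 0\<close> is small.

  The even part \<open>1 + z\<^sup>2\<close> has its maximum modulus on each circle exactly at the two real points:
  with \<open>z = x + iy\<close> and \<open>\<bar>z\<bar> = r\<close>, \<open>\<bar>1 + z\<^sup>2\<bar>\<^sup>2 = (1 + r\<^sup>2)\<^sup>2 - 4y\<^sup>2\<close>. Since \<open>O\<close> has real
  coefficients, passing from \<open>z\<close> to the nearer of the points \<open>\<plusminus>r\<close> changes the contribution of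
  \<open>\<epsilon> O\<close> to the squared modulus by at most a multiple of \<open>\<epsilon> y\<^sup>2\<close>, uniformly on an annulus
  (\<open>real_poly_near_real_axis\<close>). For small \<open>\<epsilon>\<close> the gain \<open>4y\<^sup>2\<close> wins, so the maximum modulus set is
  real on an annulus that contains all circles of radius in \<open>A\<close> (\<open>perturbed_modulus_less_real\<close>).

  The odd part decides between \<open>r\<close> and \<open>-r\<close>: \<open>p(r)\<^sup>2 - p(-r)\<^sup>2 = 4 \<epsilon> (1 + r\<^sup>2) O(r)\<close>, and \<open>O\<close> changes
  sign at each element of \<open>A\<close>. So at each \<open>a \<in> A\<close> the maximum modulus set jumps from one half of
  the real axis to the other. The component through the point at which the new half starts cannot
  reach any smaller modulus (\<open>discontinuity_of_modulus_if_switch\<close>).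
\<close>

section \<open>A switch between the two real half-axes is a discontinuity\<close>

lemma modulus_attains_max_on_circle:
  fixes f :: "complex \<Rightarrow> complex"
  assumes "continuous_on UNIV f"
  obtains m where "norm m = norm z"
    "\<And>w. norm w = norm z \<Longrightarrow> norm (f w) \<le> norm (f m)"
proof -
  let ?S = "sphere (0::complex) (norm z)"
  have "continuous_on ?S (\<lambda>w. norm (f w))"
    using assms by (intro continuous_intros) (auto intro: continuous_on_subset)
  then obtain m where "m \<in> ?S" "\<And>w. w \<in> ?S \<Longrightarrow> norm (f w) \<le> norm (f m)"
    using continuous_attains_sup[of ?S "\<lambda>w. norm (f w)"] by force
  with that[of m] show ?thesis by simp
qed

lemma max_modulus_set_iff:
  assumes "continuous_on UNIV f"
  shows "z \<in> max_modulus_set f \<longleftrightarrow> (\<forall>w. norm w = norm z \<longrightarrow> norm (f w) \<le> norm (f z))"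
proof -
  obtain m where m: "norm m = norm z" "\<And>w. norm w = norm z \<Longrightarrow> norm (f w) \<le> norm (f m)"
    using modulus_attains_max_on_circle[OF assms] by blast
  then have "max_modulus (norm z) f = norm (f m)"
    unfolding max_modulus_def by (intro cSup_eq_maximum) auto
  with m show ?thesis
    unfolding max_modulus_set_def by (auto simp: order_antisym)
qed

text \<open>
  Near the circle of radius \<open>a\<close> the maximum modulus set lies on the ray through \<open>-s\<close> for smaller
  moduli and on the ray through \<open>s\<close> for larger ones, and it contains both endpoints \<open>\<plusminus>s a\<close>. Add a
  small disc around \<open>s a\<close> to the outside of the circle and one around \<open>-s a\<close> to its inside: these
  two open sets cover the maximum modulus set and do not overlap on it, so the component of \<open>s a\<close>
  stays in the first. Away from the circle the two sets are told apart by the modulus alone, which is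
  why hypotheses near the circle suffice.
\<close>
lemma discontinuity_of_modulus_if_switch:
  assumes cont: "continuous_on UNIV f"
    and \<delta>: "0 < \<delta>" "\<delta> < a" and s: "s = 1 \<or> s = (-1::real)"
    and real: "\<And>z. z \<in> max_modulus_set f \<Longrightarrow> \<bar>norm z - a\<bar> < \<delta> \<Longrightarrow> z \<in> \<real>"
    and at: "norm (f (of_real (s * a))) = norm (f (of_real (- s * a)))"
    and above: "\<And>r. a < r \<Longrightarrow> r < a + \<delta> \<Longrightarrow>
                  norm (f (of_real (- s * r))) < norm (f (of_real (s * r)))"
    and below: "\<And>r. a - \<delta> < r \<Longrightarrow> r < a \<Longrightarrow>
                  norm (f (of_real (s * r))) < norm (f (of_real (- s * r)))"
  shows "discontinuity_of_modulus f a"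
proof -
  let ?M = "max_modulus_set f"
  define c where "c = complex_of_real (s * a)"
  have M_iff: "z \<in> ?M \<longleftrightarrow> (\<forall>w. norm w = norm z \<longrightarrow> norm (f w) \<le> norm (f z))" for z
    by (rule max_modulus_set_iff[OF cont])
  have norm_s: "norm (complex_of_real (s * r)) = r" "norm (complex_of_real (- s * r)) = r"
    if "r \<ge> 0" for r using s that by auto
  have two: "z = of_real (s * norm z) \<or> z = of_real (- s * norm z)"
    if "z \<in> ?M" "\<bar>norm z - a\<bar> < \<delta>" for z
    using real[OF that] s by (auto elim!: Reals_cases simp: abs_if)
  have norm_c: "norm c = a" unfolding c_def using norm_s \<delta> by simp
  have "c \<in> ?M"
  proof -
    obtain m where m: "norm m = norm c" "m \<in> ?M"
      using modulus_attains_max_on_circle[OF cont, of c] by (metis M_iff)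
    with two[of m] \<delta> norm_c have "m = c \<or> m = of_real (- s * a)"
      unfolding c_def by auto
    with m at have "norm (f m) = norm (f c)" unfolding c_def by auto
    with m show ?thesis by (simp add: M_iff)
  qed
  then obtain \<Gamma> where \<Gamma>: "\<Gamma> \<in> components ?M" "c \<in> \<Gamma>"
    by (metis UnionE Union_components)
  define U where "U = {z. a < norm z} \<union> ball c \<delta>"
  define V where "V = {z. norm z < a} \<union> ball (- c) \<delta>"
  have "open U" "open V"
    unfolding U_def V_def by (intro open_Un open_ball open_Collect_less continuous_intros)+
  have cover: "?M \<subseteq> U \<union> V"
  proof
    fix z assume z: "z \<in> ?M"
    show "z \<in> U \<union> V"
    proof (cases "norm z = a")
      case True
      with two[OF z] \<delta> have "z = c \<or> z = - c" unfolding c_def by auto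
      with \<delta> show ?thesis unfolding U_def V_def by auto
    qed (auto simp: U_def V_def)
  qed
  have near: "\<bar>norm z - a\<bar> < \<delta>" if "dist d z < \<delta>" "norm d = a" for z d :: complex
    using that norm_triangle_ineq3[of d z] by (simp add: dist_norm)
  have opposite: "\<not> dist (- d) z < \<delta>" if "dist d z < \<delta>" "norm d = a" for z d :: complex
  proof
    assume "dist (- d) z < \<delta>"
    then have "dist d (- d) < 2 * \<delta>"
      using that dist_triangle2[of d "- d" z] by simp
    moreover have "dist d (- d) = 2 * a"
      using that(2) by (simp add: dist_norm norm_mult flip: mult_2)
    ultimately show False using \<delta> by simp
  qed
  have disjoint: "U \<inter> V \<inter> ?M = {}"
  proof (rule ccontr)
    assume "U \<inter> V \<inter> ?M \<noteq> {}"
    then obtain z where z: "z \<in> U" "z \<in> V" "z \<in> ?M" by blast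
    from z(1,2) have "a < norm z \<or> dist c z < \<delta>" "norm z < a \<or> dist (- c) z < \<delta>"
      by (simp_all add: U_def V_def)
    then consider
        "a < norm z" "dist (- c) z < \<delta>" | "norm z < a" "dist c z < \<delta>"
      | "dist c z < \<delta>" "dist (- c) z < \<delta>"
      by (meson less_asym)
    then show False
    proof cases
      case 1
      with near[of "- c" z] norm_c have n: "\<bar>norm z - a\<bar> < \<delta>" by simp
      have "z \<noteq> of_real (s * norm z)"
      proof
        assume "z = of_real (s * norm z)"
        then have "z - c = of_real (s * norm z) - c" by (rule arg_cong)
        also have "\<dots> = of_real (s * (norm z - a))" unfolding c_def by (simp add: algebra_simps)
        finally have "norm (z - c) = norm z - a"
          using norm_s(1)[of "norm z - a"] 1 by simp
        then have "dist c z < \<delta>" using n by (simp add: dist_norm norm_minus_commute)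
        then show False using opposite[of c z] 1 norm_c by simp
      qed
      with two[OF z(3) n] have zz: "z = of_real (- s * norm z)" by simp
      have "norm (f z) < norm (f (of_real (s * norm z)))"
        using above[of "norm z"] 1 n zz by simp
      moreover have "norm (f (of_real (s * norm z))) \<le> norm (f z)"
        using z(3) norm_s(1)[of "norm z"] by (simp only: M_iff) simp
      ultimately show False by simp
    next
      case 2
      with near[of c z] norm_c have n: "\<bar>norm z - a\<bar> < \<delta>" by simp
      have "z \<noteq> of_real (- s * norm z)"
      proof
        assume "z = of_real (- s * norm z)"
        then have "z - (- c) = of_real (- s * norm z) - (- c)" by (rule arg_cong)
        also have "\<dots> = of_real (s * (a - norm z))" unfolding c_def by (simp add: algebra_simps)
        finally have "norm (z - (- c)) = a - norm z"
          using norm_s(1)[of "a - norm z"] 2 by simp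
        then have "dist (- c) z < \<delta>" using n by (simp add: dist_commute dist_norm)
        then show False using opposite[of c z] 2 norm_c by simp
      qed
      with two[OF z(3) n] have zz: "z = of_real (s * norm z)" by simp
      have "norm (f z) < norm (f (of_real (- s * norm z)))"
        using below[of "norm z"] 2 n zz by simp
      moreover have "norm (f (of_real (- s * norm z))) \<le> norm (f z)"
        using z(3) norm_s(2)[of "norm z"] by (simp only: M_iff) simp
      ultimately show False by simp
    next
      case 3
      then show False using opposite norm_c by blast
    qed
  qed
  have "a \<le> norm z" if "z \<in> \<Gamma>" for z
  proof (rule ccontr)
    assume "\<not> a \<le> norm z"
    then have "z \<in> V" unfolding V_def by simp
    have "c \<in> U" unfolding U_def using \<delta> by simp
    have "\<Gamma> \<subseteq> ?M" using \<Gamma>(1) by (rule in_components_subset)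
    have "connected \<Gamma>" using \<Gamma>(1) by (rule in_components_connected)
    then have "U \<inter> \<Gamma> = {} \<or> V \<inter> \<Gamma> = {}"
    proof (rule connectedD[OF _ \<open>open U\<close> \<open>open V\<close>])
      show "U \<inter> V \<inter> \<Gamma> = {}" using \<open>\<Gamma> \<subseteq> ?M\<close> disjoint by auto
      show "\<Gamma> \<subseteq> U \<union> V" using \<open>\<Gamma> \<subseteq> ?M\<close> cover by (rule order_trans)
    qed
    with \<open>z \<in> V\<close> \<open>c \<in> U\<close> \<Gamma>(2) that show False by auto
  qed
  then show ?thesis
    unfolding discontinuity_of_modulus_def using \<Gamma> norm_c \<delta>
    by (intro conjI bexI[of _ \<Gamma>]) auto
qed

section \<open>Confining the maximum modulus set to the real axis\<close>

text \<open>
  A polynomial with real coefficients takes conjugate values at conjugate points, so on a circle its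
  real part depends on \<open>Im z\<close> only to second order; \<open>s\<close> selects the real point of the circle that
  is nearer to \<open>z\<close>. The lower bound \<open>r\<^sub>0\<close> on the modulus keeps the distance
  \<open>\<bar>Re z - s\<bar>z\<bar>\<bar> = (Im z)\<^sup>2 / (\<bar>z\<bar> + \<bar>Re z\<bar>)\<close> of second order. The bounds on the value and on the
  imaginary part carry the induction over the coefficients.
\<close>
lemma real_poly_near_real_axis:
  fixes q :: "real poly" and r\<^sub>0 R :: real
  assumes "0 < r\<^sub>0" "r\<^sub>0 \<le> R"
  obtains C where "C \<ge> 0"
    "\<And>z s. \<lbrakk>r\<^sub>0 \<le> norm z; norm z \<le> R; s = 1 \<or> s = -1; 0 \<le> s * Re z\<rbrakk> \<Longrightarrow>
       \<bar>poly q (s * norm z)\<bar> \<le> C \<and>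
       \<bar>Re (poly (map_poly of_real q) z) - poly q (s * norm z)\<bar> \<le> C * (Im z)\<^sup>2 \<and>
       \<bar>Im (poly (map_poly of_real q) z)\<bar> \<le> C * \<bar>Im z\<bar>"
proof (induction q arbitrary: thesis)
  case 0
  show ?case by (rule 0[of 0]) auto
next
  case (pCons c q)
  obtain C where C: "C \<ge> 0"
    "\<And>z s. \<lbrakk>r\<^sub>0 \<le> norm z; norm z \<le> R; s = 1 \<or> s = -1; 0 \<le> s * Re z\<rbrakk> \<Longrightarrow>
       \<bar>poly q (s * norm z)\<bar> \<le> C \<and>
       \<bar>Re (poly (map_poly of_real q) z) - poly q (s * norm z)\<bar> \<le> C * (Im z)\<^sup>2 \<and>
       \<bar>Im (poly (map_poly of_real q) z)\<bar> \<le> C * \<bar>Im z\<bar>"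
    using pCons.IH by blast
  \<comment> \<open>From \<open>q(z)\<close> to \<open>c + z q(z)\<close> the bounds on the value, the real part and the imaginary part grow
     by the factors \<open>R\<close>, \<open>R + 1/r\<^sub>0 + 1\<close> and \<open>R + (R\<^sup>2 + 1)\<close>, up to the constant \<open>\<bar>c\<bar>\<close>.\<close>
  define K where "K = 2 + R + 1 / r\<^sub>0 + R\<^sup>2"
  have K: "R \<le> K" "R + 1 / r\<^sub>0 + 1 \<le> K" "R + (R\<^sup>2 + 1) \<le> K" and "K \<ge> 0"
    using assms unfolding K_def by (auto simp: add_nonneg_nonneg)
  show ?case
  proof (rule pCons.prems[of "\<bar>c\<bar> + C * K"])
    show "0 \<le> \<bar>c\<bar> + C * K" using \<open>C \<ge> 0\<close> \<open>K \<ge> 0\<close> by simp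
    fix z :: complex and s :: real
    assume z: "r\<^sub>0 \<le> norm z" "norm z \<le> R" and s: "s = 1 \<or> s = -1" and sz: "0 \<le> s * Re z"
    define r x y where "r = norm z" and "x = Re z" and "y = Im z"
    define u v w where "u = Re (poly (map_poly of_real q) z)"
      and "v = Im (poly (map_poly of_real q) z)" and "w = poly q (s * r)"
    have q: "\<bar>w\<bar> \<le> C" "\<bar>u - w\<bar> \<le> C * y\<^sup>2" "\<bar>v\<bar> \<le> C * \<bar>y\<bar>"
      using C(2)[OF z s sz] by (auto simp: r_def y_def u_def v_def w_def)
    have r: "r\<^sub>0 \<le> r" "r \<le> R" "0 < r" and xy: "\<bar>x\<bar> \<le> R" "\<bar>y\<bar> \<le> R"
      using z assms abs_Re_le_cmod[of z] abs_Im_le_cmod[of z] by (auto simp: r_def x_def y_def)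
    have r2: "r\<^sup>2 = x\<^sup>2 + y\<^sup>2" by (simp add: r_def x_def y_def cmod_power2)
    have "\<bar>x - s * r\<bar> = r - \<bar>x\<bar>"
      using s sz abs_Re_le_cmod[of z] by (auto simp: r_def x_def)
    moreover have "(r - \<bar>x\<bar>) * r\<^sub>0 \<le> (r - \<bar>x\<bar>) * (r + \<bar>x\<bar>)"
      using r abs_Re_le_cmod[of z] by (intro mult_left_mono) (auto simp: r_def x_def)
    moreover have "(r - \<bar>x\<bar>) * (r + \<bar>x\<bar>) = y\<^sup>2"
      using r2 by (simp add: algebra_simps power2_eq_square)
    ultimately have xsr: "\<bar>x - s * r\<bar> \<le> y\<^sup>2 / r\<^sub>0"
      using assms by (simp add: pos_le_divide_eq)
    have y2: "y\<^sup>2 \<le> R\<^sup>2" using xy(2) by (metis abs_ge_zero power2_abs power_mono)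
    have u: "\<bar>u\<bar> \<le> C * (R\<^sup>2 + 1)"
    proof -
      have "\<bar>u\<bar> \<le> C * y\<^sup>2 + C" using q by linarith
      also have "\<dots> \<le> C * R\<^sup>2 + C" using y2 C(1) by (simp add: mult_left_mono)
      finally show ?thesis by (simp add: algebra_simps)
    qed
    have 1: "\<bar>c + s * r * w\<bar> \<le> \<bar>c\<bar> + C * K"
    proof -
      have "\<bar>s * r * w\<bar> = r * \<bar>w\<bar>" using s r by (auto simp: abs_mult)
      also have "\<dots> \<le> K * C" using q(1) r K by (intro mult_mono) auto
      finally show ?thesis by (simp add: mult.commute)
    qed
    have 2: "\<bar>x * u - y * v - s * r * w\<bar> \<le> C * K * y\<^sup>2"
    proof -
      have "x * u - y * v - s * r * w = x * (u - w) + (x - s * r) * w - y * v"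
        by (simp add: algebra_simps)
      also have "\<bar>\<dots>\<bar> \<le> \<bar>x\<bar> * \<bar>u - w\<bar> + \<bar>x - s * r\<bar> * \<bar>w\<bar> + \<bar>y\<bar> * \<bar>v\<bar>"
        unfolding abs_mult[symmetric] by linarith
      also have "\<dots> \<le> R * (C * y\<^sup>2) + y\<^sup>2 / r\<^sub>0 * C + \<bar>y\<bar> * (C * \<bar>y\<bar>)"
        using q xy xsr assms by (intro add_mono mult_mono) auto
      also have "\<dots> = (R + 1 / r\<^sub>0 + 1) * (C * y\<^sup>2)"
        by (simp add: algebra_simps power2_eq_square)
      also have "\<dots> \<le> K * (C * y\<^sup>2)" using K C by (intro mult_right_mono) auto
      finally show ?thesis by (simp add: mult_ac)
    qed
    have 3: "\<bar>x * v + y * u\<bar> \<le> C * K * \<bar>y\<bar>"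
    proof -
      have "\<bar>x * v + y * u\<bar> \<le> \<bar>x\<bar> * \<bar>v\<bar> + \<bar>y\<bar> * \<bar>u\<bar>"
        unfolding abs_mult[symmetric] by linarith
      also have "\<dots> \<le> R * (C * \<bar>y\<bar>) + \<bar>y\<bar> * (C * (R\<^sup>2 + 1))"
        using q xy u assms by (intro add_mono mult_mono) auto
      also have "\<dots> = (R + (R\<^sup>2 + 1)) * (C * \<bar>y\<bar>)" by (simp add: algebra_simps)
      also have "\<dots> \<le> K * (C * \<bar>y\<bar>)" using K C by (intro mult_right_mono) auto
      finally show ?thesis by (simp add: mult_ac)
    qed
    have slack: "C * K * y\<^sup>2 \<le> (\<bar>c\<bar> + C * K) * y\<^sup>2" "C * K * \<bar>y\<bar> \<le> (\<bar>c\<bar> + C * K) * \<bar>y\<bar>"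
      by (intro mult_right_mono; simp)+
    show "\<bar>poly (pCons c q) (s * norm z)\<bar> \<le> \<bar>c\<bar> + C * K \<and>
       \<bar>Re (poly (map_poly of_real (pCons c q)) z) - poly (pCons c q) (s * norm z)\<bar>
         \<le> (\<bar>c\<bar> + C * K) * (Im z)\<^sup>2 \<and>
       \<bar>Im (poly (map_poly of_real (pCons c q)) z)\<bar> \<le> (\<bar>c\<bar> + C * K) * \<bar>Im z\<bar>"
      using 1 2 3 slack
      by (simp add: map_poly_pCons u_def v_def w_def r_def x_def y_def)
  qed
qed

text \<open>
  Moving \<open>z\<close> along its circle to the nearer real point increases the squared modulus of \<open>1 + z\<^sup>2\<close>
  by exactly \<open>4 (Im z)\<^sup>2\<close>, and changes the other terms by \<open>O(\<epsilon> (Im z)\<^sup>2)\<close>.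
\<close>
lemma perturbed_modulus_less_real:
  fixes q :: "real poly" and r\<^sub>0 R :: real
  assumes "0 < r\<^sub>0" "r\<^sub>0 \<le> R"
  obtains \<epsilon> where "\<epsilon> > 0"
    "\<And>z s. \<lbrakk>r\<^sub>0 \<le> norm z; norm z \<le> R; s = 1 \<or> s = -1; 0 \<le> s * Re z; Im z \<noteq> 0\<rbrakk> \<Longrightarrow>
       norm (1 + z\<^sup>2 + of_real \<epsilon> * poly (map_poly of_real q) z)
         < \<bar>1 + (norm z)\<^sup>2 + \<epsilon> * poly q (s * norm z)\<bar>"
proof -
  obtain C where C: "C \<ge> 0"
    "\<And>z s. \<lbrakk>r\<^sub>0 \<le> norm z; norm z \<le> R; s = 1 \<or> s = -1; 0 \<le> s * Re z\<rbrakk> \<Longrightarrow>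
       \<bar>poly q (s * norm z)\<bar> \<le> C \<and>
       \<bar>Re (poly (map_poly of_real q) z) - poly q (s * norm z)\<bar> \<le> C * (Im z)\<^sup>2 \<and>
       \<bar>Im (poly (map_poly of_real q) z)\<bar> \<le> C * \<bar>Im z\<bar>"
    using real_poly_near_real_axis[OF assms] by blast
  define L where "L = 2 * (3 * C * (1 + R\<^sup>2) + 2 * R * C) + C * C * (3 + R\<^sup>2)"
  have "L \<ge> 0" using C assms unfolding L_def by simp
  define \<epsilon> where "\<epsilon> = 1 / (1 + L)"
  have \<epsilon>: "\<epsilon> > 0" "\<epsilon> \<le> 1" "\<epsilon> * L < 4"
    using \<open>L \<ge> 0\<close> unfolding \<epsilon>_def by (auto simp: field_simps)
  show ?thesis
  proof (rule that[OF \<open>\<epsilon> > 0\<close>])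
    fix z :: complex and s :: real
    assume z: "r\<^sub>0 \<le> norm z" "norm z \<le> R" and s: "s = 1 \<or> s = -1" and sz: "0 \<le> s * Re z"
      and "Im z \<noteq> 0"
    define r x y where "r = norm z" and "x = Re z" and "y = Im z"
    define u v w where "u = Re (poly (map_poly of_real q) z)"
      and "v = Im (poly (map_poly of_real q) z)" and "w = poly q (s * r)"
    have q: "\<bar>w\<bar> \<le> C" "\<bar>u - w\<bar> \<le> C * y\<^sup>2" "\<bar>v\<bar> \<le> C * \<bar>y\<bar>"
      using C(2)[OF z s sz] by (auto simp: r_def y_def u_def v_def w_def)
    have xy: "\<bar>x\<bar> \<le> R" "\<bar>y\<bar> \<le> R" and r: "r\<^sup>2 \<le> R\<^sup>2"
      using z abs_Re_le_cmod[of z] abs_Im_le_cmod[of z]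
      by (auto simp: r_def x_def y_def intro: power_mono)
    have r2: "r\<^sup>2 = x\<^sup>2 + y\<^sup>2" by (simp add: r_def x_def y_def cmod_power2)
    have u: "\<bar>u\<bar> \<le> C * (1 + R\<^sup>2)" and uw: "\<bar>u + w\<bar> \<le> C * (2 + R\<^sup>2)"
    proof -
      have "C * y\<^sup>2 \<le> C * R\<^sup>2"
        using C(1) xy(2) by (metis abs_ge_zero mult_left_mono power2_abs power_mono)
      with q show "\<bar>u\<bar> \<le> C * (1 + R\<^sup>2)" "\<bar>u + w\<bar> \<le> C * (2 + R\<^sup>2)"
        by (auto simp: algebra_simps)
    qed
    \<comment> \<open>The squared modulus at \<open>z\<close> minus that at the real point is \<open>-4y\<^sup>2 + \<epsilon>(2E + \<epsilon>F)\<close>.\<close>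
    define E F where "E = (1 + r\<^sup>2) * (u - w) - 2 * y\<^sup>2 * u + 2 * x * y * v"
      and "F = (u - w) * (u + w) + v * v"
    have E: "\<bar>E\<bar> \<le> (3 * C * (1 + R\<^sup>2) + 2 * R * C) * y\<^sup>2"
    proof -
      have "\<bar>E\<bar> \<le> \<bar>(1 + r\<^sup>2) * (u - w)\<bar> + \<bar>2 * y\<^sup>2 * u\<bar> + \<bar>2 * x * y * v\<bar>"
        unfolding E_def by linarith
      also have "\<dots> = (1 + r\<^sup>2) * \<bar>u - w\<bar> + 2 * y\<^sup>2 * \<bar>u\<bar> + 2 * (\<bar>x\<bar> * \<bar>y\<bar>) * \<bar>v\<bar>"
        by (simp add: abs_mult)
      also have "\<dots> \<le> (1 + R\<^sup>2) * (C * y\<^sup>2) + 2 * y\<^sup>2 * (C * (1 + R\<^sup>2))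
                        + 2 * (R * \<bar>y\<bar>) * (C * \<bar>y\<bar>)"
        using q xy r u assms by (intro add_mono mult_mono) auto
      also have "\<dots> = (3 * C * (1 + R\<^sup>2) + 2 * R * C) * y\<^sup>2"
        by (simp add: algebra_simps power2_eq_square)
      finally show ?thesis .
    qed
    have F: "\<bar>F\<bar> \<le> C * C * (3 + R\<^sup>2) * y\<^sup>2"
    proof -
      have "\<bar>F\<bar> \<le> \<bar>u - w\<bar> * \<bar>u + w\<bar> + \<bar>v\<bar> * \<bar>v\<bar>"
        unfolding F_def abs_mult[symmetric] by linarith
      also have "\<dots> \<le> (C * y\<^sup>2) * (C * (2 + R\<^sup>2)) + (C * \<bar>y\<bar>) * (C * \<bar>y\<bar>)"
        using q uw C(1) by (intro add_mono mult_mono) auto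
      also have "\<dots> = C * C * (3 + R\<^sup>2) * y\<^sup>2"
        by (simp add: algebra_simps power2_eq_square)
      finally show ?thesis .
    qed
    have "2 * E + \<epsilon> * F \<le> L * y\<^sup>2"
    proof -
      have "\<epsilon> * F \<le> \<epsilon> * \<bar>F\<bar>" using \<epsilon> by (intro mult_left_mono) auto
      also have "\<dots> \<le> \<bar>F\<bar>" using \<epsilon> by (intro mult_left_le_one_le) auto
      finally show ?thesis using E F unfolding L_def by (simp add: algebra_simps)
    qed
    then have "\<epsilon> * (2 * E + \<epsilon> * F) \<le> \<epsilon> * L * y\<^sup>2"
      using \<epsilon> by (simp add: mult.assoc)
    also have "\<dots> < 4 * y\<^sup>2"
      using \<epsilon> \<open>Im z \<noteq> 0\<close> by (simp add: y_def)
    finally have "\<epsilon> * (2 * E + \<epsilon> * F) < 4 * y\<^sup>2" .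
    moreover have "(norm (1 + z\<^sup>2 + of_real \<epsilon> * poly (map_poly of_real q) z))\<^sup>2
        = (1 + x\<^sup>2 - y\<^sup>2 + \<epsilon> * u)\<^sup>2 + (2 * x * y + \<epsilon> * v)\<^sup>2"
      unfolding cmod_power2
      by (rule arg_cong2[where f = "\<lambda>a b. a\<^sup>2 + b\<^sup>2"])
        (simp_all add: x_def y_def u_def v_def power2_eq_square)
    moreover have "\<dots> = (1 + r\<^sup>2 + \<epsilon> * w)\<^sup>2 - 4 * y\<^sup>2 + \<epsilon> * (2 * E + \<epsilon> * F)"
      unfolding E_def F_def r2 by algebra
    ultimately have "(norm (1 + z\<^sup>2 + of_real \<epsilon> * poly (map_poly of_real q) z))\<^sup>2
        < \<bar>1 + r\<^sup>2 + \<epsilon> * w\<bar>\<^sup>2" by simp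
    then show "norm (1 + z\<^sup>2 + of_real \<epsilon> * poly (map_poly of_real q) z)
         < \<bar>1 + (norm z)\<^sup>2 + \<epsilon> * poly q (s * norm z)\<bar>"
      unfolding r_def[symmetric] w_def[symmetric] by (rule power_less_imp_less_base) simp
  qed
qed

section \<open>The odd part\<close>

definition switching_poly :: "real set \<Rightarrow> real poly" where
  "switching_poly A = [:0, 1:] * (\<Prod>b\<in>A. [:- b\<^sup>2, 0, 1:])"

lemma poly_switching_poly: "poly (switching_poly A) x = x * (\<Prod>b\<in>A. x\<^sup>2 - b\<^sup>2)"
  by (simp add: switching_poly_def poly_prod power2_eq_square)

lemma degree_switching_poly:
  assumes "finite A"
  shows "degree (switching_poly A) = 2 * card A + 1"
proof -
  have "degree (\<Prod>b\<in>A. [:- b\<^sup>2, 0, 1:]) = 2 * card A"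
    by (subst degree_prod_eq_sum_degree) auto
  moreover have "(\<Prod>b\<in>A. [:- b\<^sup>2, 0, 1:]) \<noteq> 0"
    using assms by auto
  ultimately show ?thesis
    unfolding switching_poly_def by (subst degree_mult_eq) auto
qed

text \<open>
  Each \<open>a \<in> A\<close> is a simple root, since all elements of \<open>A\<close> are positive and so the factors
  \<open>x\<^sup>2 - b\<^sup>2\<close> have disjoint root sets. The sign \<open>s\<close> is that of the cofactor of \<open>x - a\<close> at \<open>a\<close>.
\<close>
lemma switching_poly_sign_change:
  assumes "finite A" "\<And>b. b \<in> A \<Longrightarrow> b > 0" "a \<in> A"
  obtains s \<delta> where "s = 1 \<or> s = (-1::real)" "\<delta> > 0"
    "\<And>r. a < r \<Longrightarrow> r < a + \<delta> \<Longrightarrow> s * poly (switching_poly A) r > 0"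
    "\<And>r. a - \<delta> < r \<Longrightarrow> r < a \<Longrightarrow> s * poly (switching_poly A) r < 0"
proof -
  define h where "h = (\<lambda>r. r * (r + a) * (\<Prod>b\<in>A - {a}. r\<^sup>2 - b\<^sup>2))"
  have factor: "poly (switching_poly A) r = (r - a) * h r" for r
    using assms(1,3)
    by (simp add: poly_switching_poly h_def prod.remove[of A a] power2_eq_square algebra_simps)
  have "a > 0" using assms by blast
  have "b > 0" if "b \<in> A" for b using assms that by blast
  then have "h a \<noteq> 0"
    using \<open>a > 0\<close> assms(1) by (force simp: h_def power2_eq_iff)
  define s where "s = sgn (h a)"
  have "s = 1 \<or> s = -1" using \<open>h a \<noteq> 0\<close> by (auto simp: s_def sgn_if)
  have "isCont (\<lambda>r. s * h r) a" unfolding h_def by (intro continuous_intros)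
  moreover have "s * h a > 0" using \<open>h a \<noteq> 0\<close> by (simp add: s_def sgn_if)
  ultimately have "eventually (\<lambda>r. s * h r > 0) (nhds a)"
    by (metis isCont_def order_tendstoD(1) tendsto_at_iff_tendsto_nhds)
  then obtain \<delta> where "\<delta> > 0" and \<delta>: "\<And>r. dist r a < \<delta> \<Longrightarrow> s * h r > 0"
    unfolding eventually_nhds_metric by blast
  have *: "s * poly (switching_poly A) r = (r - a) * (s * h r)" for r
    by (simp add: factor)
  show ?thesis
  proof (rule that[OF \<open>s = 1 \<or> s = -1\<close> \<open>\<delta> > 0\<close>])
    show "s * poly (switching_poly A) r > 0" if "a < r" "r < a + \<delta>" for r
      unfolding * using that \<delta>[of r] by (simp add: dist_real_def)
    show "s * poly (switching_poly A) r < 0" if "a - \<delta> < r" "r < a" for r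
      unfolding * using that \<delta>[of r] by (simp add: dist_real_def mult_neg_pos)
  qed
qed

section \<open>Existence of the polynomial\<close>

lemma poly_map_poly_of_real:
  "poly (map_poly of_real q) (of_real x) = (of_real (poly q x) :: complex)"
  by (induction q) (simp_all add: map_poly_pCons)

lemma discontinuities_of_even_plus_small_odd:
  assumes A: "finite A" "A \<noteq> {}" "\<And>b. b \<in> A \<Longrightarrow> b > 0"
  obtains \<epsilon> where "\<epsilon> > 0"
    "\<And>a. a \<in> A \<Longrightarrow> discontinuity_of_modulus
       (\<lambda>z. 1 + z\<^sup>2 + of_real \<epsilon> * poly (map_poly of_real (switching_poly A)) z) a"
proof -
  let ?q = "switching_poly A"
  define r\<^sub>0 R where "r\<^sub>0 = Min A / 2" and "R = Max A + 1"
  have pos: "0 < r\<^sub>0" using A by (simp add: r\<^sub>0_def)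
  have range: "2 * r\<^sub>0 \<le> a" "a + 1 \<le> R" if "a \<in> A" for a
    using A that by (simp_all add: r\<^sub>0_def R_def)
  have "r\<^sub>0 \<le> R" using A range pos by fastforce
  obtain \<epsilon> where \<epsilon>: "\<epsilon> > 0"
    "\<And>z s. \<lbrakk>r\<^sub>0 \<le> norm z; norm z \<le> R; s = 1 \<or> s = -1; 0 \<le> s * Re z; Im z \<noteq> 0\<rbrakk> \<Longrightarrow>
       norm (1 + z\<^sup>2 + of_real \<epsilon> * poly (map_poly of_real ?q) z)
         < \<bar>1 + (norm z)\<^sup>2 + \<epsilon> * poly ?q (s * norm z)\<bar>"
    using perturbed_modulus_less_real[OF pos \<open>r\<^sub>0 \<le> R\<close>] by metis
  define f where "f = (\<lambda>z::complex. 1 + z\<^sup>2 + of_real \<epsilon> * poly (map_poly of_real ?q) z)"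
  have f_real: "norm (f (of_real x)) = \<bar>1 + x\<^sup>2 + \<epsilon> * poly ?q x\<bar>" for x
  proof -
    have "f (of_real x) = of_real (1 + x\<^sup>2 + \<epsilon> * poly ?q x)"
      by (simp add: f_def poly_map_poly_of_real)
    then show ?thesis by (simp only: norm_of_real real_norm_def)
  qed
  have cont: "continuous_on UNIV f"
    unfolding f_def by (intro continuous_intros)
  show ?thesis
  proof (rule that[OF \<open>\<epsilon> > 0\<close>])
    fix a assume a: "a \<in> A"
    obtain s \<delta> where s: "s = 1 \<or> s = (-1::real)" and "\<delta> > 0"
      and up: "\<And>r. a < r \<Longrightarrow> r < a + \<delta> \<Longrightarrow> s * poly ?q r > 0"
      and down: "\<And>r. a - \<delta> < r \<Longrightarrow> r < a \<Longrightarrow> s * poly ?q r < 0"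
      using switching_poly_sign_change[OF A(1,3) a] by metis
    have f_s: "norm (f (of_real (s * r))) = \<bar>1 + r\<^sup>2 + \<epsilon> * (s * poly ?q r)\<bar>"
         "norm (f (of_real (- s * r))) = \<bar>1 + r\<^sup>2 - \<epsilon> * (s * poly ?q r)\<bar>" for r
      unfolding f_real using s by (auto simp: poly_switching_poly)
    have larger: "\<bar>b - t\<bar> < \<bar>b + t\<bar>" if "b > 0" "t > 0" for b t :: real using that by auto
    \<comment> \<open>Since \<open>2r\<^sub>0 \<le> a \<le> R - 1\<close>, the annulus of half-width \<open>\<eta>\<close> about the circle of radius \<open>a\<close> stays
       between the radii \<open>r\<^sub>0\<close> and \<open>R\<close>.\<close>
    define \<eta> where "\<eta> = min \<delta> (min r\<^sub>0 1)"
    have \<eta>: "0 < \<eta>" "\<eta> \<le> \<delta>" "\<eta> \<le> r\<^sub>0" "\<eta> \<le> 1" using \<open>\<delta> > 0\<close> pos by (auto simp: \<eta>_def)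
    have "discontinuity_of_modulus f a"
    proof (rule discontinuity_of_modulus_if_switch[OF cont _ _ s, where \<delta> = \<eta>])
      show "0 < \<eta>" "\<eta> < a" using \<eta> range[OF a] pos by auto
      show "z \<in> \<real>" if z: "z \<in> max_modulus_set f" "\<bar>norm z - a\<bar> < \<eta>" for z
      proof (rule ccontr)
        assume "z \<notin> \<real>"
        then have "Im z \<noteq> 0" by (simp add: complex_is_Real_iff)
        define t where "t = (if Re z \<ge> 0 then 1 else -1 :: real)"
        have t: "t = 1 \<or> t = -1" "0 \<le> t * Re z" by (auto simp: t_def)
        have ann: "r\<^sub>0 \<le> norm z" "norm z \<le> R" using z(2) \<eta> range[OF a] by auto
        have "norm (f z) < norm (f (of_real (t * norm z)))"
          using \<epsilon>(2)[OF ann t \<open>Im z \<noteq> 0\<close>] t(1) unfolding f_real by (auto simp: f_def)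
        moreover have "norm (complex_of_real (t * norm z)) = norm z" using t(1) by auto
        ultimately show False
          using z(1) unfolding max_modulus_set_iff[OF cont] by fastforce
      qed
      show "norm (f (of_real (s * a))) = norm (f (of_real (- s * a)))"
      proof -
        have "poly ?q a = 0" using A(1) a by (auto simp: poly_switching_poly)
        then show ?thesis by (simp only: f_s)
      qed
      show "norm (f (of_real (- s * r))) < norm (f (of_real (s * r)))"
        if "a < r" "r < a + \<eta>" for r
      proof -
        have "\<epsilon> * (s * poly ?q r) > 0"
          using that \<eta> by (intro mult_pos_pos[OF \<epsilon>(1) up]) auto
        with larger show ?thesis
          unfolding f_s by (simp add: add_pos_nonneg)
      qed
      show "norm (f (of_real (s * r))) < norm (f (of_real (- s * r)))"
        if "a - \<eta> < r" "r < a" for r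
      proof -
        have "- (\<epsilon> * (s * poly ?q r)) > 0"
          using \<epsilon>(1) down[of r] that \<eta> by (simp add: mult_pos_neg)
        from larger[OF _ this, of "1 + r\<^sup>2"] show ?thesis
          unfolding f_s by (simp add: add_pos_nonneg)
      qed
    qed
    then show "discontinuity_of_modulus
       (\<lambda>z. 1 + z\<^sup>2 + of_real \<epsilon> * poly (map_poly of_real ?q) z) a"
      by (simp add: f_def)
  qed
qed

theorem theorem1p2:
  fixes n :: nat and a :: "nat \<Rightarrow> real"
  assumes "\<And>k. k \<in> {1..n} \<Longrightarrow> a k > 0"
    and "inj_on a {1..n}"
  shows "\<exists>p :: complex poly. degree p = 2 * n + 1 \<and>
           (\<forall>k\<in>{1..n}. discontinuity_of_modulus (poly p) (a k))"
proof (cases "n = 0")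
  \<comment> \<open>Here \<open>1 + z\<^sup>2 + \<epsilon> z\<close> has the wrong degree: the even part dominates.\<close>
  case True
  then show ?thesis by (intro exI[of _ "[:0, 1:]"]) simp
next
  case False
  let ?A = "a ` {1..n}"
  let ?Q = "map_poly complex_of_real (switching_poly ?A)"
  have "finite ?A" "?A \<noteq> {}" "\<And>b. b \<in> ?A \<Longrightarrow> b > 0" using False assms(1) by auto
  then obtain \<epsilon> where \<epsilon>: "\<epsilon> > 0"
    "\<And>b. b \<in> ?A \<Longrightarrow> discontinuity_of_modulus (\<lambda>z. 1 + z\<^sup>2 + of_real \<epsilon> * poly ?Q z) b"
    using discontinuities_of_even_plus_small_odd[of ?A] by metis
  define p where "p = [:1, 0, 1:] + smult (of_real \<epsilon>) ?Q"
  have "degree ?Q = 2 * n + 1"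
    using assms(2) by (simp add: degree_map_poly degree_switching_poly card_image)
  then have "degree p = 2 * n + 1"
    unfolding p_def using False \<epsilon>(1) by (subst degree_add_eq_right) auto
  moreover have "poly p = (\<lambda>z. 1 + z\<^sup>2 + of_real \<epsilon> * poly ?Q z)"
    by (simp add: p_def fun_eq_iff power2_eq_square)
  ultimately show ?thesis using \<epsilon>(2) by (intro exI[of _ p]) simp
qed

end
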